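(* Let $\mathcal{A},\mathcal{B}\in\mathrm{T}^m(\mathbb{R}^n)$, let $a(x)=x\circ\mathcal{A}x^{m-1}$, $b(x)=x\circ\mathcal{B}x^{m-1}$, and let $$h(x)=\Big(x^Tx-1,\ \big(a(x)_ib(x)_j-b(x)_ia(x)_j\big)_{1\le i<j\le n}\Big).$$ If $\mathcal{A},\mathcal{B}$ are generic tensors, then $V_{\mathbb{C}}(h)=\{u\in\mathbb{C}^n:h(u)=0\}$ and $V_{\mathbb{R}}(h)=V_{\mathbb{C}}(h)\cap\mathbb{R}^n$ are finite sets.
   Context: $\mathrm{T}^m(\mathbb{R}^n)$ is the space of real $m$-th order $n$-dimensional tensors (not necessarily symmetric). For a vector $x$ of dimension $n$, $(\mathcal{A}x^{m-1})_i=\sum_{i_2,\ldots,i_m=1}^n\mathcal{A}_{i,i_2,\ldots,i_m}x_{i_2}\cdots x_{i_m}$; $\circ$ is the entrywise product of vectors; $x^Tx=\sum_i x_i^2$ (also for complex $x$). A property holds for generic $\mathcal{A},\mathcal{B}$ if it holds for all pairs $(\mathcal{A},\mathcal{B})$ in an open dense subset, in the Zariski topology, of the space of pairs $\mathrm{T}^m(\mathbb{R}^n)\times\mathrm{T}^m(\mathbb{R}^n)$. *)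

theory Defs
  imports "HOL-Analysis.Analysis"
begin

text \<open>
  The Zariski topology on a finite-dimensional real vector space: a set is closed iff it is the
  common zero locus of a (possibly infinite) set of real polynomial functions.
\<close>

definition zariski_open :: "'a::euclidean_space set \<Rightarrow> bool" where
  "zariski_open U \<longleftrightarrow>
     (\<exists>S. (\<forall>p\<in>S. real_polynomial_function p) \<and> - U = {x. \<forall>p\<in>S. p x = 0})"

definition zariski_topology :: "'a::euclidean_space topology" where
  "zariski_topology = topology zariski_open"

lemma istopology_zariski_open: "istopology (zariski_open :: 'a::euclidean_space set \<Rightarrow> bool)"
  unfolding istopology_def
proof (intro conjI allI impI)
  fix U V :: "'a set"
  assume "zariski_open U" "zariski_open V"
  then obtain S T where S: "\<forall>p\<in>S. real_polynomial_function p" "- U = {x. \<forall>p\<in>S. p x = 0}"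
    and T: "\<forall>p\<in>T. real_polynomial_function p" "- V = {x. \<forall>p\<in>T. p x = 0}"
    unfolding zariski_open_def by (elim exE conjE)
  let ?P = "\<Union>p\<in>S. (\<lambda>q x. p x * q x) ` T"
  have "\<forall>p\<in>?P. real_polynomial_function p"
    using S(1) T(1) by (simp add: real_polynomial_function.intros(4))
  moreover have "- (U \<inter> V) = {x. \<forall>p\<in>?P. p x = 0}"
  proof -
    have "- (U \<inter> V) = {x. \<forall>p\<in>S. p x = 0} \<union> {x. \<forall>p\<in>T. p x = 0}"
      by (simp only: Compl_Int S(2) T(2))
    also have "\<dots> = {x. \<forall>p\<in>S. \<forall>q\<in>T. p x * q x = 0}"
      by auto
    also have "\<dots> = {x. \<forall>p\<in>?P. p x = 0}"
      by simp
    finally show ?thesis .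
  qed
  ultimately show "zariski_open (U \<inter> V)"
    unfolding zariski_open_def by (intro exI[of _ ?P] conjI)
next
  fix K :: "'a set set"
  assume "\<forall>U\<in>K. zariski_open U"
  then have "\<exists>S. \<forall>U\<in>K. (\<forall>p\<in>S U. real_polynomial_function p) \<and>
      - U = {x. \<forall>p\<in>S U. p x = 0}"
    unfolding zariski_open_def by (rule bchoice)
  then obtain S where S: "\<forall>U\<in>K. (\<forall>p\<in>S U. real_polynomial_function p) \<and>
      - U = {x. \<forall>p\<in>S U. p x = 0}" ..
  have "- \<Union>K = (\<Inter>U\<in>K. - U)"
    by blast
  also have "\<dots> = {x. \<forall>p\<in>(\<Union>U\<in>K. S U). p x = 0}"
    using S by (simp add: set_eq_iff)
  finally show "zariski_open (\<Union>K)"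
    unfolding zariski_open_def using S by (intro exI[of _ "\<Union>U\<in>K. S U"] conjI) simp_all
qed

lemma openin_zariski_topology: "openin zariski_topology U \<longleftrightarrow> zariski_open U"
  by (simp add: zariski_topology_def topology_inverse'[OF istopology_zariski_open])

lemma topspace_zariski_topology: "topspace zariski_topology = UNIV"
proof -
  have "zariski_open (UNIV :: 'a set)"
    unfolding zariski_open_def
    by (rule exI[of _ "{\<lambda>_. 1}"]) (simp add: real_polynomial_function.intros(2))
  then show ?thesis
    by (metis openin_subset openin_zariski_topology top.extremum_uniqueI)
qed

definition holds_generically :: "('a::euclidean_space \<Rightarrow> bool) \<Rightarrow> bool" where
  "holds_generically P \<longleftrightarrow>
     (\<exists>U. openin zariski_topology U \<and>
          zariski_topology closure_of U = topspace zariski_topology \<and>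
          (\<forall>z\<in>U. P z))"

text \<open>
  A tensor of order \<open>m = CARD('m)\<close> and dimension \<open>n = CARD('n)\<close> is a family of real entries
  \<open>A $ J\<close>, one for each multi-index \<open>J :: 'm \<Rightarrow> 'n\<close>: the entry in position
  \<open>(i\<^sub>1, \<dots>, i\<^sub>m)\<close> is the one whose \<open>J\<close> maps the \<open>k\<close>-th element of the finite linear order \<open>'m\<close>
  to \<open>i\<^sub>k\<close>.  The first mode is the least element of \<open>'m\<close>.
\<close>

type_synonym ('m, 'n) tensor = "real ^ ('m \<Rightarrow> 'n)"

definition first_mode :: "'m::{finite,linorder}" where
  "first_mode = Min UNIV"

definition tensor_apply ::
  "('m::{finite,linorder}, 'n::finite) tensor \<Rightarrow> complex ^ 'n \<Rightarrow> complex ^ 'n" where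
  "tensor_apply A x =
     (\<chi> i. \<Sum>J | J first_mode = i.
        complex_of_real (A $ J) * (\<Prod>k \<in> UNIV - {first_mode}. x $ J k))"

definition hadamard :: "complex ^ 'n \<Rightarrow> complex ^ 'n \<Rightarrow> complex ^ 'n" (infixl "\<circ>\<^sub>H" 70) where
  "x \<circ>\<^sub>H y = (\<chi> i. x $ i * y $ i)"

text \<open>The components of \<open>h\<close>; note that \<open>x\<^sup>T x\<close> involves no complex conjugation.\<close>

definition h_sphere :: "complex ^ 'n::finite \<Rightarrow> complex" where
  "h_sphere x = (\<Sum>i\<in>UNIV. (x $ i)\<^sup>2) - 1"

definition h_minor ::
  "('m::{finite,linorder}, 'n::finite) tensor \<Rightarrow> ('m, 'n) tensor \<Rightarrow> 'n \<Rightarrow> 'n \<Rightarrow> complex ^ 'n \<Rightarrow> complex"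
where
  "h_minor A B i j x =
     (let a = x \<circ>\<^sub>H tensor_apply A x; b = x \<circ>\<^sub>H tensor_apply B x
      in a $ i * b $ j - b $ i * a $ j)"

definition V_complex ::
  "('m::{finite,linorder}, 'n::{finite,linorder}) tensor \<Rightarrow> ('m, 'n) tensor \<Rightarrow>
     (complex ^ 'n::{finite,linorder}) set"
where
  "V_complex A B = {u. h_sphere u = 0 \<and> (\<forall>i j. i < j \<longrightarrow> h_minor A B i j u = 0)}"

definition V_real ::
  "('m::{finite,linorder}, 'n::{finite,linorder}) tensor \<Rightarrow> ('m, 'n) tensor \<Rightarrow>
     (complex ^ 'n::{finite,linorder}) set"
where
  "V_real A B = V_complex A B \<inter> {u. \<forall>i. u $ i \<in> \<real>}"

end

theory Submission
  imports Defs
begin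

text \<open>
  Take \<open>A\<close> diagonal with entries \<open>1\<close> and \<open>B\<close> diagonal with distinct entries. For this pair the minors
  are nonzero multiples of \<open>x\<^sub>i\<^sup>m x\<^sub>j\<^sup>m\<close>, and together with \<open>x\<^sup>T x\<close> these forms generate an ideal that
  contains every monomial of degree \<open>d = n m + 2\<close>: by pigeonhole some exponent \<open>\<beta>\<^sub>i\<close> is at least \<open>m\<close>;
  if no other exponent is, then \<open>\<beta>\<^sub>i \<ge> m + 2\<close>, and \<open>x\<^sup>T x\<close> trades \<open>x\<^sub>i\<^sup>2\<close> for the other squares.
  That the multiples of the forms fill degree \<open>d\<close> is an open condition on the coefficients, so for
  generic \<open>A, B\<close> every monomial of degree \<open>d\<close> agrees on \<open>V\<^sub>\<complex>(h)\<close> with a polynomial of lower degree.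
  All powers of a coordinate then lie in a space of functions on \<open>V\<^sub>\<complex>(h)\<close> of finite dimension, so each
  coordinate is a root of a fixed nonzero polynomial and takes finitely many values.
\<close>

section \<open>Monomials, their exponent vectors and degrees\<close>

definition monomial :: "('n::finite \<Rightarrow> nat) \<Rightarrow> complex ^ 'n \<Rightarrow> complex" where
  "monomial \<alpha> x = (\<Prod>i\<in>UNIV. x $ i ^ \<alpha> i)"

definition deg :: "('n::finite \<Rightarrow> nat) \<Rightarrow> nat" where
  "deg \<alpha> = (\<Sum>i\<in>UNIV. \<alpha> i)"

definition single :: "'n \<Rightarrow> nat \<Rightarrow> 'n \<Rightarrow> nat" where
  "single i k = (\<lambda>j. if j = i then k else 0)"

text \<open>The exponent vector of the monomial that the entry at \<open>J\<close> contributes to x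
  \<circ> Ax^{m-1}. All modes are counted, because the Hadamard factor supplies the variable of the
  first mode.\<close>

definition index_count :: "('m::finite \<Rightarrow> 'n) \<Rightarrow> 'n \<Rightarrow> nat" where
  "index_count J = (\<lambda>i. card {k. J k = i})"

lemma monomial_add: "monomial (\<lambda>i. \<alpha> i + \<beta> i) x = monomial \<alpha> x * monomial \<beta> x"
  by (simp add: monomial_def power_add prod.distrib)

lemma monomial_single: "monomial (single i k) x = x $ i ^ k"
proof -
  have "monomial (single i k) x = (\<Prod>j\<in>UNIV. if j = i then x $ j ^ k else 1)"
    unfolding monomial_def single_def by (intro prod.cong) auto
  then show ?thesis by simp
qed

lemma monomial_index_count: "monomial (index_count J) x = (\<Prod>k\<in>UNIV. x $ J k)"
proof -
  have "(\<Prod>k\<in>UNIV. x $ J k) = (\<Prod>i\<in>UNIV. \<Prod>k\<in>{k\<in>UNIV. J k = i}. x $ J k)"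
    by (rule prod.group[symmetric]) auto
  also have "\<dots> = (\<Prod>i\<in>UNIV. x $ i ^ card {k. J k = i})"
    by (intro prod.cong) auto
  finally show ?thesis unfolding monomial_def index_count_def by (rule sym)
qed

lemma deg_add: "deg (\<lambda>i. \<alpha> i + \<beta> i) = deg \<alpha> + deg \<beta>"
  by (simp add: deg_def sum.distrib)

lemma deg_single: "deg (single i k) = k"
  by (simp add: deg_def single_def)

lemma deg_index_count: "deg (index_count (J :: 'm::finite \<Rightarrow> 'n::finite)) = CARD('m)"
proof -
  have "(\<Sum>k::'m\<in>UNIV. (1::nat)) = (\<Sum>i\<in>UNIV. \<Sum>k\<in>{k\<in>UNIV. J k = i}. 1)"
    by (rule sum.group[symmetric]) auto
  then show ?thesis unfolding deg_def index_count_def by simp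
qed

lemma index_count_const: "index_count (\<lambda>_::'m::finite. i) = single i CARD('m)"
  unfolding index_count_def single_def by (intro ext) auto

lemma finite_deg_less: "finite {\<alpha> :: 'n::finite \<Rightarrow> nat. deg \<alpha> < d}"
proof (rule finite_subset)
  show "{\<alpha> :: 'n \<Rightarrow> nat. deg \<alpha> < d} \<subseteq> PiE UNIV (\<lambda>_. {..<d})"
  proof (clarsimp simp: PiE_UNIV_domain)
    fix \<alpha> :: "'n \<Rightarrow> nat" and i
    assume "deg \<alpha> < d"
    moreover have "\<alpha> i \<le> deg \<alpha>"
      unfolding deg_def by (rule member_le_sum) auto
    ultimately show "\<alpha> i < d" by simp
  qed
qed (intro finite_PiE, auto)

lemma finite_deg_eq: "finite {\<alpha> :: 'n::finite \<Rightarrow> nat. deg \<alpha> = d}"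
  by (rule finite_subset[OF _ finite_deg_less[of "Suc d"]]) auto

text \<open>Collecting like terms: \<open>\<phi>\<close> need not be injective, as different
  multi-indices can give the same monomial.\<close>

lemma sum_monomial_regroup:
  assumes "finite P" "\<And>p. p \<in> P \<Longrightarrow> deg (\<phi> p) = d"
  shows "(\<Sum>\<alpha> | deg \<alpha> = d. (\<Sum>p | p \<in> P \<and> \<phi> p = \<alpha>. q p) * monomial \<alpha> x)
    = (\<Sum>p\<in>P. q p * monomial (\<phi> p) x)"
proof -
  have "(\<Sum>p\<in>P. q p * monomial (\<phi> p) x)
      = (\<Sum>\<alpha> | deg \<alpha> = d. \<Sum>p\<in>{p\<in>P. \<phi> p = \<alpha>}. q p * monomial (\<phi> p) x)"
    by (rule sum.group[symmetric]) (use assms finite_deg_eq in auto)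
  also have "\<dots> = (\<Sum>\<alpha> | deg \<alpha> = d. (\<Sum>p | p \<in> P \<and> \<phi> p = \<alpha>. q p) * monomial \<alpha> x)"
    unfolding sum_distrib_right by (intro sum.cong) auto
  finally show ?thesis by simp
qed

section \<open>Linear algebra: subspaces of functions, elimination, linear dependence\<close>

text \<open>Membership in such an \<open>S\<close> plays the part of being congruent to zero. In the
  application \<open>S\<close> consists of the functions that have lower degree on the
  variety.\<close>

definition fun_subspace :: "('x \<Rightarrow> complex) set \<Rightarrow> bool" where
  "fun_subspace S \<longleftrightarrow> (\<lambda>_. 0) \<in> S \<and> (\<forall>f\<in>S. \<forall>g\<in>S. (\<lambda>x. f x + g x) \<in> S) \<and>
     (\<forall>f\<in>S. \<forall>c. (\<lambda>x. c * f x) \<in> S)"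

lemma fun_subspace_add: "fun_subspace S \<Longrightarrow> f \<in> S \<Longrightarrow> g \<in> S \<Longrightarrow> (\<lambda>x. f x + g x) \<in> S"
  and fun_subspace_scale: "fun_subspace S \<Longrightarrow> f \<in> S \<Longrightarrow> (\<lambda>x. c * f x) \<in> S"
  by (auto simp: fun_subspace_def)

lemma fun_subspace_diff:
  assumes "fun_subspace S" "f \<in> S" "g \<in> S"
  shows "(\<lambda>x. f x - g x) \<in> S"
  using fun_subspace_add[OF assms(1,2) fun_subspace_scale[OF assms(1,3), of "-1"]] by simp

lemma fun_subspace_sum:
  assumes "fun_subspace S" "\<And>p. p \<in> P \<Longrightarrow> f p \<in> S"
  shows "(\<lambda>x. \<Sum>p\<in>P. f p x) \<in> S"
  using assms(2)
proof (induction P rule: infinite_finite_induct)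
  case (insert p P)
  then have "(\<lambda>x. f p x + (\<Sum>p\<in>P. f p x)) \<in> S"
    by (intro fun_subspace_add assms(1)) auto
  with insert show ?case by simp
qed (use assms(1) in \<open>auto simp: fun_subspace_def\<close>)

text \<open>Fraction-free Gaussian elimination, with the pivots collected in the polynomial \<open>p\<close>.\<close>

lemma generic_elimination:
  fixes M :: "'z::real_normed_vector \<Rightarrow> 'b \<Rightarrow> 'b \<Rightarrow> real"
  assumes "finite F"
    and "\<And>\<alpha> \<beta>. \<alpha> \<in> F \<Longrightarrow> \<beta> \<in> F \<Longrightarrow> real_polynomial_function (\<lambda>z. M z \<alpha> \<beta>)"
    and "\<And>\<alpha> \<beta>. \<alpha> \<in> F \<Longrightarrow> \<beta> \<in> F \<Longrightarrow> M z0 \<alpha> \<beta> = (if \<beta> = \<alpha> then 1 else 0)"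
  shows "\<exists>p. real_polynomial_function p \<and> p z0 \<noteq> 0 \<and>
    (\<forall>z S y. p z \<noteq> 0 \<longrightarrow> fun_subspace S \<longrightarrow>
      (\<forall>\<alpha>\<in>F. (\<lambda>x::'x. \<Sum>\<beta>\<in>F. complex_of_real (M z \<alpha> \<beta>) * y \<beta> x) \<in> S) \<longrightarrow> (\<forall>\<beta>\<in>F. y \<beta> \<in> S))"
  using assms
proof (induction F arbitrary: M rule: finite_induct)
  case empty
  show ?case
    by (rule exI[of _ "\<lambda>_. 1"]) (simp add: real_polynomial_function.intros)
next
  case (insert a F)
  \<comment> \<open>This matrix is again the identity at \<open>z0\<close>, because there the pivot
    is 1 and the column entry \<open>M z0 \<alpha> a\<close> is 0. So the induction hypothesis
    applies to it.\<close>
  define N where "N z \<alpha> \<beta> = M z a a * M z \<alpha> \<beta> - M z \<alpha> a * M z a \<beta>" for z \<alpha> \<beta>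
  have "\<exists>p. real_polynomial_function p \<and> p z0 \<noteq> 0 \<and>
    (\<forall>z S y. p z \<noteq> 0 \<longrightarrow> fun_subspace S \<longrightarrow>
      (\<forall>\<alpha>\<in>F. (\<lambda>x::'x. \<Sum>\<beta>\<in>F. complex_of_real (N z \<alpha> \<beta>) * y \<beta> x) \<in> S) \<longrightarrow> (\<forall>\<beta>\<in>F. y \<beta> \<in> S))"
  proof (rule insert.IH)
    fix \<alpha> \<beta> assume *: "\<alpha> \<in> F" "\<beta> \<in> F"
    show "real_polynomial_function (\<lambda>z. N z \<alpha> \<beta>)"
      unfolding N_def using * insert.prems(1)
      by (intro real_polynomial_function_diff real_polynomial_function.intros(4)) auto
    from * insert.hyps have "\<alpha> \<noteq> a" "\<beta> \<noteq> a" by auto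
    with * show "N z0 \<alpha> \<beta> = (if \<beta> = \<alpha> then 1 else 0)"
      by (simp add: N_def insert.prems(2))
  qed
  then obtain p where p: "real_polynomial_function p" "p z0 \<noteq> 0"
    and elim: "\<forall>z S y. p z \<noteq> 0 \<longrightarrow> fun_subspace S \<longrightarrow>
      (\<forall>\<alpha>\<in>F. (\<lambda>x::'x. \<Sum>\<beta>\<in>F. complex_of_real (N z \<alpha> \<beta>) * y \<beta> x) \<in> S) \<longrightarrow> (\<forall>\<beta>\<in>F. y \<beta> \<in> S)"
    by (elim exE conjE)
  show ?case
  proof (intro exI[of _ "\<lambda>z. M z a a * p z"] conjI allI impI)
    show "real_polynomial_function (\<lambda>z. M z a a * p z)"
      using p insert.prems by (intro real_polynomial_function.intros(4)) auto
    show "M z0 a a * p z0 \<noteq> 0"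
      using p insert.prems by simp
    fix z S and y :: "'b \<Rightarrow> 'x \<Rightarrow> complex"
    assume "M z a a * p z \<noteq> 0" and S: "fun_subspace S"
      and rows: "\<forall>\<alpha>\<in>insert a F. (\<lambda>x. \<Sum>\<beta>\<in>insert a F. complex_of_real (M z \<alpha> \<beta>) * y \<beta> x) \<in> S"
    then have nz: "M z a a \<noteq> 0" "p z \<noteq> 0" by auto
    have rows': "(\<lambda>x. M z \<alpha> a * y a x + (\<Sum>\<beta>\<in>F. complex_of_real (M z \<alpha> \<beta>) * y \<beta> x)) \<in> S"
      if "\<alpha> \<in> insert a F" for \<alpha>
      using bspec[OF rows that] insert.hyps by simp
    have yF: "y \<beta> \<in> S" if "\<beta> \<in> F" for \<beta>
    proof (rule elim[rule_format, OF nz(2) S _ that])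
      fix \<alpha> assume "\<alpha> \<in> F"
      \<comment> \<open>The cross-multiplied rows cancel the terms in \<open>y a\<close>; what is
        left is row \<open>\<alpha>\<close> of \<open>N\<close>.\<close>
      then have "(\<lambda>x. complex_of_real (M z a a) * (M z \<alpha> a * y a x + (\<Sum>\<beta>\<in>F. M z \<alpha> \<beta> * y \<beta> x))
          - complex_of_real (M z \<alpha> a) * (M z a a * y a x + (\<Sum>\<beta>\<in>F. M z a \<beta> * y \<beta> x))) \<in> S"
        by (intro fun_subspace_diff fun_subspace_scale S rows') auto
      then show "(\<lambda>x. \<Sum>\<beta>\<in>F. complex_of_real (N z \<alpha> \<beta>) * y \<beta> x) \<in> S"
        by (simp add: N_def algebra_simps sum_subtractf sum_distrib_left)
    qed
    \<comment> \<open>Back substitution: row \<open>a\<close> minus its terms in \<open>F\<close> is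
      a nonzero multiple of \<open>y a\<close>.\<close>
    have "(\<lambda>x. (1 / complex_of_real (M z a a)) * ((M z a a * y a x + (\<Sum>\<beta>\<in>F. M z a \<beta> * y \<beta> x))
          - (\<Sum>\<beta>\<in>F. M z a \<beta> * y \<beta> x))) \<in> S"
      by (intro fun_subspace_scale fun_subspace_diff fun_subspace_sum S rows' yF) auto
    with nz have "y a \<in> S" by simp
    with yF show "\<forall>\<beta>\<in>insert a F. y \<beta> \<in> S" by auto
  qed
qed

text \<open>Induction on the equations: an unknown with nonzero coefficient in equation
  \<open>a\<close> is eliminated from the others, which removes one equation and one unknown and
  keeps the strict inequality.\<close>

lemma underdetermined_system_nontrivial:
  fixes l :: "'k \<Rightarrow> 'e \<Rightarrow> 'f::field"
  assumes "finite E" "finite K" "card E < card K"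
  shows "\<exists>c. (\<exists>k\<in>K. c k \<noteq> 0) \<and> (\<forall>e\<in>E. (\<Sum>k\<in>K. c k * l k e) = 0)"
  using assms
proof (induction E arbitrary: K l rule: finite_induct)
  case empty
  then have "K \<noteq> {}" by auto
  then show ?case by (intro exI[of _ "\<lambda>_. 1"]) auto
next
  case (insert a E)
  show ?case
  proof (cases "\<forall>k\<in>K. l k a = 0")
    case True
    have "\<exists>c. (\<exists>k\<in>K. c k \<noteq> 0) \<and> (\<forall>e\<in>E. (\<Sum>k\<in>K. c k * l k e) = 0)"
      using insert by auto
    with True show ?thesis by auto
  next
    case False
    then obtain k0 where k0: "k0 \<in> K" "l k0 a \<noteq> 0" by auto
    have "\<exists>c. (\<exists>k\<in>K - {k0}. c k \<noteq> 0) \<and>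
        (\<forall>e\<in>E. (\<Sum>k\<in>K - {k0}. c k * (l k e - l k a / l k0 a * l k0 e)) = 0)"
      using insert k0 by (intro insert.IH) auto
    then obtain c where c: "\<exists>k\<in>K - {k0}. c k \<noteq> 0"
      "\<And>e. e \<in> E \<Longrightarrow> (\<Sum>k\<in>K - {k0}. c k * (l k e - l k a / l k0 a * l k0 e)) = 0"
      by auto
    \<comment> \<open>The value of the eliminated unknown that equation \<open>a\<close>
      forces.\<close>
    define t where "t = - (\<Sum>k\<in>K - {k0}. c k * l k a) / l k0 a"
    have split: "(\<Sum>k\<in>K. (c(k0 := t)) k * l k e) = t * l k0 e + (\<Sum>k\<in>K - {k0}. c k * l k e)" for e
      using insert.prems k0 by (subst sum.remove[of _ k0]) (auto intro!: sum.cong)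
    have "(\<Sum>k\<in>K. (c(k0 := t)) k * l k e) = 0" if "e \<in> insert a E" for e
    proof (cases "e = a")
      case True
      with k0 show ?thesis unfolding split by (simp add: t_def)
    next
      case False
      with that have "e \<in> E" by simp
      then have "0 = (\<Sum>k\<in>K - {k0}. c k * l k e) - (\<Sum>k\<in>K - {k0}. c k * l k a) / l k0 a * l k0 e"
        using c(2)[of e]
        by (simp add: right_diff_distrib sum_subtractf sum_distrib_right sum_divide_distrib mult.assoc)
      then show ?thesis unfolding split by (simp add: t_def)
    qed
    moreover have "\<exists>k\<in>K. (c(k0 := t)) k \<noteq> 0" using c(1) by auto
    ultimately show ?thesis by blast
  qed
qed

section \<open>Functions of lower degree on a set, and the finiteness criterion\<close>

text \<open>Agreement is required on \<open>V\<close> only, so the equations of \<open>V\<close> may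
  be used to lower a degree.\<close>

definition lower_on :: "nat \<Rightarrow> (complex ^ 'n::finite) set \<Rightarrow> (complex ^ 'n \<Rightarrow> complex) set" where
  "lower_on d V = {f. \<exists>l. \<forall>x\<in>V. f x = (\<Sum>\<alpha> | deg \<alpha> < d. l \<alpha> * monomial \<alpha> x)}"

lemma fun_subspace_lower_on:
  fixes V :: "(complex ^ 'n::finite) set"
  shows "fun_subspace (lower_on d V)"
  unfolding fun_subspace_def
proof (intro conjI ballI allI)
  show "(\<lambda>_. 0) \<in> lower_on d V"
    unfolding lower_on_def by (auto intro: exI[of _ "\<lambda>_. 0"])
next
  fix f g :: "complex ^ 'n \<Rightarrow> complex" assume "f \<in> lower_on d V" "g \<in> lower_on d V"
  then obtain l k where "\<forall>x\<in>V. f x = (\<Sum>\<alpha> | deg \<alpha> < d. l \<alpha> * monomial \<alpha> x)"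
    "\<forall>x\<in>V. g x = (\<Sum>\<alpha> | deg \<alpha> < d. k \<alpha> * monomial \<alpha> x)"
    unfolding lower_on_def by auto
  then show "(\<lambda>x. f x + g x) \<in> lower_on d V"
    unfolding lower_on_def
    by (auto intro!: exI[of _ "\<lambda>\<alpha>. l \<alpha> + k \<alpha>"] simp: distrib_right sum.distrib)
next
  fix f :: "complex ^ 'n \<Rightarrow> complex" and c assume "f \<in> lower_on d V"
  then obtain l where "\<forall>x\<in>V. f x = (\<Sum>\<alpha> | deg \<alpha> < d. l \<alpha> * monomial \<alpha> x)"
    unfolding lower_on_def by auto
  then show "(\<lambda>x. c * f x) \<in> lower_on d V"
    unfolding lower_on_def
    by (auto intro!: exI[of _ "\<lambda>\<alpha>. c * l \<alpha>"] simp: sum_distrib_left mult.assoc)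
qed

lemma monomial_in_lower_on:
  fixes \<alpha> :: "'n::finite \<Rightarrow> nat"
  assumes "deg \<alpha> < d"
  shows "monomial \<alpha> \<in> lower_on d V"
proof -
  have "(\<Sum>\<beta> | deg \<beta> < d. (if \<beta> = \<alpha> then 1 else 0) * monomial \<beta> x)
      = (\<Sum>\<beta> | deg \<beta> < d. if \<beta> = \<alpha> then monomial \<beta> x else 0)" for x
    by (intro sum.cong) auto
  also have "\<dots> x = monomial \<alpha> x" for x
    using assms by (simp add: finite_deg_less)
  finally show ?thesis
    unfolding lower_on_def by (intro CollectI exI[of _ "\<lambda>\<beta>. if \<beta> = \<alpha> then 1 else 0"]) simp
qed

lemma lower_on_cong:
  fixes V :: "(complex ^ 'n::finite) set"
  shows "f \<in> lower_on d V \<Longrightarrow> (\<And>x. x \<in> V \<Longrightarrow> f x = g x) \<Longrightarrow> g \<in> lower_on d V"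
  unfolding lower_on_def by auto

text \<open>A coordinate raises the degree of a monomial by one: the product either stays below
  \<open>d\<close> or has degree exactly \<open>d\<close>, where \<open>top\<close> applies.\<close>

lemma lower_on_mult_coord:
  fixes V :: "(complex ^ 'n::finite) set"
  assumes top: "\<And>\<beta>. deg \<beta> = d \<Longrightarrow> monomial \<beta> \<in> lower_on d V" and f: "f \<in> lower_on d V"
  shows "(\<lambda>x. x $ i * f x) \<in> lower_on d V"
proof -
  from f obtain l where l: "\<And>x. x \<in> V \<Longrightarrow> f x = (\<Sum>\<alpha> | deg \<alpha> < d. l \<alpha> * monomial \<alpha> x)"
    unfolding lower_on_def by auto
  have shift: "monomial (\<lambda>j. single i 1 j + \<alpha> j) \<in> lower_on d V" if "deg \<alpha> < d" for \<alpha>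
  proof -
    have "deg (\<lambda>j. single i 1 j + \<alpha> j) = Suc (deg \<alpha>)" by (simp add: deg_add deg_single)
    with that show ?thesis
      by (metis Suc_lessI monomial_in_lower_on top)
  qed
  have "(\<lambda>x. \<Sum>\<alpha> | deg \<alpha> < d. l \<alpha> * monomial (\<lambda>j. single i 1 j + \<alpha> j) x) \<in> lower_on d V"
    by (intro fun_subspace_sum fun_subspace_scale fun_subspace_lower_on shift) auto
  then show ?thesis
    by (rule lower_on_cong)
       (simp add: l monomial_add monomial_single sum_distrib_left mult_ac)
qed

lemma finite_if_top_monomials_lower:
  fixes V :: "(complex ^ 'n::finite) set"
  assumes "d > 0" and top: "\<And>\<beta>. deg \<beta> = d \<Longrightarrow> monomial \<beta> \<in> lower_on d V"
  shows "finite V"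
proof -
  define E where "E = {\<alpha> :: 'n \<Rightarrow> nat. deg \<alpha> < d}"
  have coord: "finite ((\<lambda>x. x $ i) ` V)" for i
  proof -
    have "(\<lambda>x. x $ i ^ k) \<in> lower_on d V" for k
    proof (induction k)
      case 0
      \<comment> \<open>The constant 1 has degree 0, which is below \<open>d\<close> since
        \<open>d\<close> is positive.\<close>
      have "monomial (\<lambda>_. 0) \<in> lower_on d V"
        using \<open>d > 0\<close> by (intro monomial_in_lower_on) (simp add: deg_def)
      then show ?case by (rule lower_on_cong) (simp add: monomial_def)
    next
      case (Suc k)
      from lower_on_mult_coord[OF top this, of i] show ?case by simp
    qed
    then have "\<forall>k. \<exists>l. \<forall>x\<in>V. x $ i ^ k = (\<Sum>\<alpha>\<in>E. l \<alpha> * monomial \<alpha> x)"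
      unfolding lower_on_def E_def by auto
    then obtain l where l: "\<And>k x. x \<in> V \<Longrightarrow> x $ i ^ k = (\<Sum>\<alpha>\<in>E. l k \<alpha> * monomial \<alpha> x)"
      by metis
    \<comment> \<open>There are \<open>card E + 1\<close> powers and only \<open>card E\<close>
      monomials, so some nontrivial combination of the powers has all its coefficients zero.\<close>
    obtain c where c: "\<exists>k\<in>{..card E}. c k \<noteq> 0"
      "\<And>\<alpha>. \<alpha> \<in> E \<Longrightarrow> (\<Sum>k\<le>card E. c k * l k \<alpha>) = 0"
      using underdetermined_system_nontrivial[of E "{..card E}" l] finite_deg_less[of d]
      unfolding E_def by auto
    have "(\<Sum>k\<le>card E. c k * (x $ i) ^ k) = 0" if "x \<in> V" for x
    proof -
      have "(\<Sum>k\<le>card E. c k * (x $ i) ^ k) = (\<Sum>k\<le>card E. \<Sum>\<alpha>\<in>E. c k * l k \<alpha> * monomial \<alpha> x)"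
        using that by (simp add: l sum_distrib_left mult.assoc)
      also have "\<dots> = (\<Sum>\<alpha>\<in>E. (\<Sum>k\<le>card E. c k * l k \<alpha>) * monomial \<alpha> x)"
        unfolding sum_distrib_right by (rule sum.swap)
      finally show ?thesis by (simp add: c)
    qed
    then have "(\<lambda>x. x $ i) ` V \<subseteq> {w. (\<Sum>k\<le>card E. c k * w ^ k) = 0}" by auto
    moreover have "finite {w. (\<Sum>k\<le>card E. c k * w ^ k) = 0}"
      using polyfun_finite_roots[of c "card E"] c(1) by auto
    ultimately show ?thesis by (rule finite_subset)
  qed
  \<comment> \<open>\<open>V\<close> embeds in the product of its finite coordinate
    projections.\<close>
  have "finite (vec_nth ` V)"
  proof (rule finite_subset)
    show "vec_nth ` V \<subseteq> PiE UNIV (\<lambda>i. (\<lambda>x. x $ i) ` V)"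
      by (auto simp: PiE_UNIV_domain)
    show "finite (PiE UNIV (\<lambda>i. (\<lambda>x. x $ i) ` V))"
      using coord by (intro finite_PiE) auto
  qed
  then show ?thesis
    by (rule finite_imageD) (auto simp: inj_on_def vec_nth_inject)
qed

section \<open>Families of relations depending polynomially on the tensors\<close>

text \<open>
  Such a family is a multiple of the equations of \<open>V z\<close> of degree at most \<open>d\<close>, of which only the
  coefficients of degree exactly \<open>d\<close> are recorded.
\<close>

definition relation_family ::
  "('z::real_normed_vector \<Rightarrow> (complex ^ 'n::finite) set) \<Rightarrow> nat \<Rightarrow> ('z \<Rightarrow> ('n \<Rightarrow> nat) \<Rightarrow> real) \<Rightarrow> bool" where
  "relation_family V d c \<longleftrightarrow> (\<forall>\<alpha>. real_polynomial_function (\<lambda>z. c z \<alpha>)) \<and>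
     (\<forall>z. (\<lambda>x. \<Sum>\<alpha> | deg \<alpha> = d. complex_of_real (c z \<alpha>) * monomial \<alpha> x) \<in> lower_on d (V z))"

text \<open>At \<open>z0\<close> the recorded coefficients are a row of the identity matrix. One
  such family for each \<open>\<beta>\<close> of degree \<open>d\<close> gives a square matrix,
  polynomial in \<open>z\<close>, of the kind that \<open>generic_elimination\<close> takes.\<close>

definition attains ::
  "('z::real_normed_vector \<Rightarrow> (complex ^ 'n::finite) set) \<Rightarrow> 'z \<Rightarrow> nat \<Rightarrow> ('n \<Rightarrow> nat) \<Rightarrow> bool" where
  "attains V z0 d \<beta> \<longleftrightarrow>
     (\<exists>c. relation_family V d c \<and> (\<forall>\<alpha>. c z0 \<alpha> = (if \<alpha> = \<beta> then 1 else 0)))"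

lemma relation_family_diff:
  assumes "relation_family V d c" "relation_family V d c'"
  shows "relation_family V d (\<lambda>z \<alpha>. c z \<alpha> - c' z \<alpha>)"
  using assms unfolding relation_family_def
  by (simp add: real_polynomial_function_diff left_diff_distrib sum_subtractf
      fun_subspace_diff[OF fun_subspace_lower_on])

lemma relation_family_sum:
  assumes "finite K" "\<And>k. k \<in> K \<Longrightarrow> relation_family V d (c k)"
  shows "relation_family V d (\<lambda>z \<alpha>. \<Sum>k\<in>K. c k z \<alpha>)"
  unfolding relation_family_def
proof (intro conjI allI)
  show "real_polynomial_function (\<lambda>z. \<Sum>k\<in>K. c k z \<alpha>)" for \<alpha>
    using assms unfolding relation_family_def by (intro real_polynomial_function_sum) auto
  fix z
  have "(\<lambda>x. \<Sum>k\<in>K. \<Sum>\<alpha> | deg \<alpha> = d. complex_of_real (c k z \<alpha>) * monomial \<alpha> x) \<in> lower_on d (V z)"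
    by (rule fun_subspace_sum[OF fun_subspace_lower_on])
      (use assms in \<open>auto simp: relation_family_def\<close>)
  then show "(\<lambda>x. \<Sum>\<alpha> | deg \<alpha> = d. complex_of_real (\<Sum>k\<in>K. c k z \<alpha>) * monomial \<alpha> x) \<in> lower_on d (V z)"
    by (rule lower_on_cong) (subst sum.swap, simp add: sum_distrib_right)
qed

text \<open>The equations come as sums over pairs of multi-indices or over coordinates; this turns
  such a sum into coefficients indexed by exponent vectors.\<close>

lemma relation_family_regroup:
  assumes "finite P" "\<And>p. p \<in> P \<Longrightarrow> deg (\<phi> p) = d"
    and "\<And>p. p \<in> P \<Longrightarrow> real_polynomial_function (\<lambda>z. q z p)"
    and "\<And>z. (\<lambda>x. \<Sum>p\<in>P. complex_of_real (q z p) * monomial (\<phi> p) x) \<in> lower_on d (V z)"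
  shows "relation_family V d (\<lambda>z \<alpha>. \<Sum>p | p \<in> P \<and> \<phi> p = \<alpha>. q z p)"
  unfolding relation_family_def
proof (intro conjI allI)
  show "real_polynomial_function (\<lambda>z. \<Sum>p | p \<in> P \<and> \<phi> p = \<alpha>. q z p)" for \<alpha>
    using assms by (intro real_polynomial_function_sum) auto
  show "(\<lambda>x. \<Sum>\<alpha> | deg \<alpha> = d. complex_of_real (\<Sum>p | p \<in> P \<and> \<phi> p = \<alpha>. q z p) * monomial \<alpha> x)
      \<in> lower_on d (V z)" for z
    unfolding of_real_sum using assms(4)[of z] by (subst sum_monomial_regroup[OF assms(1,2)]) auto
qed

text \<open>The attaining families are the rows of a matrix that is the identity at
  \<open>z0\<close>. Off the zeros of the pivot polynomial, elimination modulo
  \<open>lower_on d (V z)\<close> puts every monomial of degree \<open>d\<close> in that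
  space.\<close>

lemma generically_finite_if_attains:
  fixes V :: "'z::real_normed_vector \<Rightarrow> (complex ^ 'n::finite) set"
  assumes "d > 0" and att: "\<And>\<beta>. deg \<beta> = d \<Longrightarrow> attains V z0 d \<beta>"
  shows "\<exists>p. real_polynomial_function p \<and> p z0 \<noteq> 0 \<and> (\<forall>z. p z \<noteq> 0 \<longrightarrow> finite (V z))"
proof -
  obtain c where c: "\<And>\<beta>. deg \<beta> = d \<Longrightarrow> relation_family V d (c \<beta>)"
    "\<And>\<alpha> \<beta>. deg \<beta> = d \<Longrightarrow> c \<beta> z0 \<alpha> = (if \<alpha> = \<beta> then 1 else 0)"
    using att unfolding attains_def by metis
  have "\<exists>p. real_polynomial_function p \<and> p z0 \<noteq> 0 \<and>
    (\<forall>z S y. p z \<noteq> 0 \<longrightarrow> fun_subspace S \<longrightarrow>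
      (\<forall>\<alpha>\<in>{\<alpha>. deg \<alpha> = d}. (\<lambda>x::complex ^ 'n. \<Sum>\<beta>\<in>{\<beta>. deg \<beta> = d}.
        complex_of_real (c \<alpha> z \<beta>) * y \<beta> x) \<in> S) \<longrightarrow> (\<forall>\<beta>\<in>{\<beta>. deg \<beta> = d}. y \<beta> \<in> S))"
    using c unfolding relation_family_def by (intro generic_elimination finite_deg_eq) auto
  then obtain p where p: "real_polynomial_function p" "p z0 \<noteq> 0"
    and elim: "\<forall>z S y. p z \<noteq> 0 \<longrightarrow> fun_subspace S \<longrightarrow>
      (\<forall>\<alpha>\<in>{\<alpha>. deg \<alpha> = d}. (\<lambda>x::complex ^ 'n. \<Sum>\<beta>\<in>{\<beta>. deg \<beta> = d}.
        complex_of_real (c \<alpha> z \<beta>) * y \<beta> x) \<in> S) \<longrightarrow> (\<forall>\<beta>\<in>{\<beta>. deg \<beta> = d}. y \<beta> \<in> S)"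
    by (elim exE conjE)
  have "finite (V z)" if "p z \<noteq> 0" for z
  proof -
    have "\<forall>\<beta>\<in>{\<beta>. deg \<beta> = d}. monomial \<beta> \<in> lower_on d (V z)"
      by (rule elim[THEN spec, THEN spec, THEN spec, THEN mp, THEN mp, THEN mp, OF that fun_subspace_lower_on])
         (use c(1) in \<open>auto simp: relation_family_def\<close>)
    then show ?thesis
      by (intro finite_if_top_monomials_lower[OF \<open>d > 0\<close>]) auto
  qed
  with p show ?thesis by blast
qed

text \<open>Multiply x^T x = 1 by x^\<gamma>: on \<open>V z\<close> the sum of all x^\<gamma> x_j^2
  equals x^\<gamma>, of degree \<open>d - 2\<close>. Subtracting the families for j \<noteq> i
  leaves x^\<gamma> x_i^2 at \<open>z0\<close>.\<close>

lemma attains_sphere: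
  fixes V :: "'z::real_normed_vector \<Rightarrow> (complex ^ 'n::finite) set"
  assumes sphere: "\<And>z x. x \<in> V z \<Longrightarrow> h_sphere x = 0"
    and d: "deg \<gamma> + 2 = d"
    and others: "\<And>j. j \<noteq> i \<Longrightarrow> attains V z0 d (\<lambda>k. \<gamma> k + single j 2 k)"
  shows "attains V z0 d (\<lambda>k. \<gamma> k + single i 2 k)"
proof -
  define b where "b j = (\<lambda>k. \<gamma> k + single j 2 k)" for j
  obtain c where c: "\<And>j. j \<noteq> i \<Longrightarrow> relation_family V d (c j)"
    "\<And>j \<alpha>. j \<noteq> i \<Longrightarrow> c j z0 \<alpha> = (if \<alpha> = b j then 1 else 0)"
    using others unfolding attains_def b_def by metis
  define s :: "'z \<Rightarrow> ('n \<Rightarrow> nat) \<Rightarrow> real" where "s z \<alpha> = (\<Sum>j | j \<in> UNIV \<and> b j = \<alpha>. 1)" for z \<alpha>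
  \<comment> \<open>In this form the summand for \<open>i\<close> can be split off.\<close>
  have s: "s z \<alpha> = (\<Sum>j\<in>UNIV. if \<alpha> = b j then 1 else 0)" for z \<alpha>
  proof -
    have "s z \<alpha> = (\<Sum>j | j \<in> UNIV \<and> \<alpha> = b j. 1)" unfolding s_def by (intro sum.cong) auto
    then show ?thesis by (simp add: sum.inter_filter[symmetric])
  qed
  have "relation_family V d s"
    unfolding s_def
  proof (rule relation_family_regroup)
    show "deg (b j) = d" for j
      using d by (simp add: b_def deg_add deg_single)
    fix z
    have "monomial \<gamma> \<in> lower_on d (V z)" using d by (intro monomial_in_lower_on) simp
    then show "(\<lambda>x. \<Sum>j\<in>UNIV. complex_of_real 1 * monomial (b j) x) \<in> lower_on d (V z)"
    proof (rule lower_on_cong)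
      fix x assume "x \<in> V z"
      then have "(\<Sum>j\<in>UNIV. (x $ j)\<^sup>2) = 1" using sphere by (auto simp: h_sphere_def)
      then show "monomial \<gamma> x = (\<Sum>j\<in>UNIV. complex_of_real 1 * monomial (b j) x)"
        by (simp add: b_def monomial_add monomial_single sum_distrib_left[symmetric])
    qed
  qed (auto intro: real_polynomial_function.intros)
  then have "relation_family V d (\<lambda>z \<alpha>. s z \<alpha> - (\<Sum>j\<in>- {i}. c j z \<alpha>))"
    by (intro relation_family_diff relation_family_sum c) auto
  moreover have "s z0 \<alpha> - (\<Sum>j\<in>- {i}. c j z0 \<alpha>) = (if \<alpha> = b i then 1 else 0)" for \<alpha>
  proof -
    have "(\<Sum>j\<in>- {i}. c j z0 \<alpha>) = (\<Sum>j\<in>UNIV - {i}. if \<alpha> = b j then 1 else 0)"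
      by (intro sum.cong) (auto simp: c)
    then show ?thesis unfolding s by (subst sum.remove[of _ i]) auto
  qed
  ultimately show ?thesis unfolding attains_def b_def by blast
qed

section \<open>Expansion of the minors, and the diagonal base point\<close>

text \<open>The factor x_i is the one that the product over the modes other than the first leaves
  out.\<close>

lemma hadamard_tensor_apply:
  "(x \<circ>\<^sub>H tensor_apply A x) $ i = (\<Sum>J | J first_mode = i. complex_of_real (A $ J) * monomial (index_count J) x)"
proof -
  have "x $ i * (complex_of_real (A $ J) * (\<Prod>k\<in>UNIV - {first_mode}. x $ J k))
      = complex_of_real (A $ J) * monomial (index_count J) x" if "J first_mode = i" for J
    unfolding monomial_index_count using that by (subst prod.remove[of UNIV first_mode]) auto
  then have "(\<Sum>J | J first_mode = i.
      x $ i * (complex_of_real (A $ J) * (\<Prod>k\<in>UNIV - {first_mode}. x $ J k)))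
      = (\<Sum>J | J first_mode = i. complex_of_real (A $ J) * monomial (index_count J) x)"
    by (intro sum.cong) auto
  then show ?thesis
    by (simp add: hadamard_def tensor_apply_def sum_distrib_left)
qed

text \<open>The coefficient of one product of two monomials in a minor, before like terms are
  collected. It is quadratic in the tensor entries, hence polynomial in \<open>z\<close>.\<close>

definition minor_coeff :: "('m::finite, 'n::finite) tensor \<times> ('m, 'n) tensor \<Rightarrow>
    ('m \<Rightarrow> 'n) \<times> ('m \<Rightarrow> 'n) \<Rightarrow> real" where
  "minor_coeff z p = fst z $ fst p * snd z $ snd p - snd z $ fst p * fst z $ snd p"

lemma h_minor_expand:
  "h_minor A B i j x = (\<Sum>p\<in>{J. J first_mode = i} \<times> {K. K first_mode = j}.
     complex_of_real (minor_coeff (A, B) p) * (monomial (index_count (fst p)) x * monomial (index_count (snd p)) x))"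
  unfolding h_minor_def Let_def hadamard_tensor_apply sum_product sum_subtractf[symmetric]
    sum.cartesian_product
  by (intro sum.cong) (auto simp: minor_coeff_def algebra_simps)

definition diagonal_tensor :: "('n \<Rightarrow> real) \<Rightarrow> ('m::{finite,linorder}, 'n::finite) tensor" where
  "diagonal_tensor w = (\<chi> J. if J = (\<lambda>_. J first_mode) then w (J first_mode) else 0)"

lemma real_polynomial_function_minor_coeff: "real_polynomial_function (\<lambda>z. minor_coeff z p)"
  unfolding minor_coeff_def
  by (intro real_polynomial_function_diff real_polynomial_function.intros(4)
      real_polynomial_function.intros(1) bounded_linear_vec_nth
      bounded_linear_compose[OF bounded_linear_vec_nth bounded_linear_fst]
      bounded_linear_compose[OF bounded_linear_vec_nth bounded_linear_snd])

text \<open>Both products in \<open>minor_coeff\<close> vanish unless both multi-indices are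
  constant; then they equal \<open>w j\<close> and \<open>w i\<close>.\<close>

lemma minor_coeff_diagonal:
  fixes p :: "('m::{finite,linorder} \<Rightarrow> 'n::finite) \<times> ('m \<Rightarrow> 'n)"
  assumes "fst p first_mode = i" "snd p first_mode = j"
  shows "minor_coeff (diagonal_tensor (\<lambda>_. 1), diagonal_tensor w) p
    = (if p = (\<lambda>_. i, \<lambda>_. j) then w j - w i else 0)"
  using assms by (cases p) (auto simp: minor_coeff_def diagonal_tensor_def)

text \<open>The family is x^\<gamma> times the minor, divided by its only nonzero coefficient at
  \<open>z0\<close>.\<close>

lemma attains_minor:
  fixes w :: "'n::{finite,linorder} \<Rightarrow> real"
    and z0 :: "('m::{finite,linorder}, 'n) tensor \<times> ('m, 'n) tensor"
  assumes w: "inj w" and z0: "z0 = (diagonal_tensor (\<lambda>_. 1), diagonal_tensor w)"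
    and "i \<noteq> j" and d: "deg \<gamma> + 2 * CARD('m) = d"
  shows "attains (\<lambda>(A :: ('m, 'n) tensor, B). V_complex A B) z0 d
    (\<lambda>k. \<gamma> k + (single i CARD('m) k + single j CARD('m) k))"
  using \<open>i \<noteq> j\<close>
\<comment> \<open>The equations of \<open>V_complex\<close> contain the minors for
  \<open>i < j\<close> only, while the exponent vector is symmetric in \<open>i\<close> and
  \<open>j\<close>.\<close>
proof (induction i j rule: linorder_wlog)
  case (le i j)
  define P where "P = {J :: 'm \<Rightarrow> 'n. J first_mode = i} \<times> {K :: 'm \<Rightarrow> 'n. K first_mode = j}"
  define \<phi> :: "('m \<Rightarrow> 'n) \<times> ('m \<Rightarrow> 'n) \<Rightarrow> 'n \<Rightarrow> nat"
    where "\<phi> p = (\<lambda>k. \<gamma> k + (index_count (fst p) k + index_count (snd p) k))" for p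
  \<comment> \<open>The divisor is a constant independent of \<open>z\<close>, so the coefficients
    remain polynomial.\<close>
  define q where "q z p = minor_coeff z p / (w j - w i)" for z :: "('m, 'n) tensor \<times> ('m, 'n) tensor" and p
  have "relation_family (\<lambda>(A, B). V_complex A B) d (\<lambda>z \<alpha>. \<Sum>p | p \<in> P \<and> \<phi> p = \<alpha>. q z p)"
  proof (rule relation_family_regroup)
    show "deg (\<phi> p) = d" for p
      using d by (simp add: \<phi>_def deg_add deg_index_count)
    show "real_polynomial_function (\<lambda>z. q z p)" for p
      unfolding q_def by (intro real_polynomial_function_divide real_polynomial_function_minor_coeff)
    fix z :: "('m, 'n) tensor \<times> ('m, 'n) tensor"
    obtain A B where z: "z = (A, B)" by (cases z)
    have "(\<lambda>_. 0) \<in> lower_on d (V_complex A B)"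
      using fun_subspace_lower_on unfolding fun_subspace_def by blast
    then have "(\<lambda>x. \<Sum>p\<in>P. complex_of_real (q z p) * monomial (\<phi> p) x) \<in> lower_on d (V_complex A B)"
    proof (rule lower_on_cong)
      fix x assume "x \<in> V_complex A B"
      with le have "h_minor A B i j x = 0" by (auto simp: V_complex_def)
      then have "0 = monomial \<gamma> x / (w j - w i) * h_minor A B i j x" by simp
      also have "\<dots> = (\<Sum>p\<in>P. complex_of_real (q z p) * monomial (\<phi> p) x)"
        unfolding h_minor_expand P_def[symmetric] sum_distrib_left
        by (intro sum.cong) (simp_all add: q_def z \<phi>_def monomial_add mult_ac)
      finally show "0 = \<dots>" .
    qed
    with z show "(\<lambda>x. \<Sum>p\<in>P. complex_of_real (q z p) * monomial (\<phi> p) x)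
        \<in> lower_on d (case z of (A, B) \<Rightarrow> V_complex A B)" by simp
  qed (simp add: P_def)
  moreover have "(\<Sum>p | p \<in> P \<and> \<phi> p = \<alpha>. q z0 p)
      = (if \<alpha> = (\<lambda>k. \<gamma> k + (single i CARD('m) k + single j CARD('m) k)) then 1 else 0)" for \<alpha>
  proof -
    \<comment> \<open>The pair of constant multi-indices, the only one that survives at
      \<open>z0\<close>.\<close>
    define e :: "('m \<Rightarrow> 'n) \<times> ('m \<Rightarrow> 'n)" where "e = (\<lambda>_. i, \<lambda>_. j)"
    have "w i \<noteq> w j" using w le by (auto dest: injD)
    then have "q z0 p = (if p = e then 1 else 0)" if "p \<in> P" for p
      using that by (auto simp: q_def z0 P_def minor_coeff_diagonal e_def)
    then have "(\<Sum>p | p \<in> P \<and> \<phi> p = \<alpha>. q z0 p) = (\<Sum>p | p \<in> P \<and> \<phi> p = \<alpha>. if p = e then 1 else 0)"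
      by (intro sum.cong) auto
    also have "\<dots> = (if \<phi> e = \<alpha> then 1 else 0)"
      by (auto simp: P_def e_def)
    also have "\<phi> e = (\<lambda>k. \<gamma> k + (single i CARD('m) k + single j CARD('m) k))"
      by (simp add: \<phi>_def e_def index_count_const)
    finally show ?thesis by auto
  qed
  ultimately show ?case unfolding attains_def by blast
next
  case (sym i j)
  then show ?case by (simp add: add.commute)
qed

section \<open>Every monomial of degree nm + 2 is attained\<close>

lemma exists_large_entry:
  fixes \<alpha> :: "'n \<Rightarrow> nat"
  assumes "(\<Sum>i\<in>I. \<alpha> i) > card I * (m - 1)"
  shows "\<exists>i\<in>I. m \<le> \<alpha> i"
proof (rule ccontr)
  assume "\<not> ?thesis"
  then have "\<alpha> i \<le> m - 1" if "i \<in> I" for i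
    using that by force
  then have "(\<Sum>i\<in>I. \<alpha> i) \<le> card I * (m - 1)"
    using sum_bounded_above[of I \<alpha> "m - 1"] by simp
  with assms show False by simp
qed

lemma attains_all:
  fixes w :: "'n::{finite,linorder} \<Rightarrow> real"
    and z0 :: "('m::{finite,linorder}, 'n) tensor \<times> ('m, 'n) tensor"
  assumes w: "inj w" and z0: "z0 = (diagonal_tensor (\<lambda>_. 1), diagonal_tensor w)"
    and d: "d = CARD('n) * CARD('m) + 2" and \<beta>: "deg \<beta> = d"
  shows "attains (\<lambda>(A :: ('m, 'n) tensor, B). V_complex A B) z0 d \<beta>"
proof -
  let ?V = "\<lambda>(A :: ('m, 'n) tensor, B). V_complex A B"
  let ?m = "CARD('m)"
  have two: "attains ?V z0 d \<beta>" if "deg \<beta> = d" "i \<noteq> j" "?m \<le> \<beta> i" "?m \<le> \<beta> j" for \<beta> i j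
  proof -
    define \<gamma> where "\<gamma> k = \<beta> k - (single i ?m k + single j ?m k)" for k
    \<comment> \<open>The truncated subtraction in \<open>\<gamma>\<close> is exact: the two
      supports are disjoint and both exponents are at least \<open>m\<close>.\<close>
    have eq: "\<beta> = (\<lambda>k. \<gamma> k + (single i ?m k + single j ?m k))"
      using that by (auto simp: \<gamma>_def single_def)
    have "deg \<beta> = deg \<gamma> + 2 * ?m"
      by (subst eq) (simp add: deg_add deg_single)
    with that have "attains ?V z0 d (\<lambda>k. \<gamma> k + (single i ?m k + single j ?m k))"
      by (intro attains_minor[OF w z0]) auto
    with eq show ?thesis by simp
  qed
  have one: "attains ?V z0 d \<beta>" if "deg \<beta> = d" "?m \<le> \<beta> i" for \<beta> i
    using that
  \<comment> \<open>Each use of the sphere lowers the exponent of \<open>i\<close> by 2 and, in the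
    case \<open>m + 2 \<le> \<beta> i\<close>, leaves it at least \<open>m\<close>.\<close>
  proof (induction "\<beta> i" arbitrary: \<beta> rule: less_induct)
    case less
    show ?case
    proof (cases "?m + 2 \<le> \<beta> i")
      case True
      define \<gamma> where "\<gamma> k = \<beta> k - single i 2 k" for k
      have eq: "\<beta> = (\<lambda>k. \<gamma> k + single i 2 k)"
        using True by (auto simp: \<gamma>_def single_def)
      have "deg \<beta> = deg \<gamma> + 2"
        by (subst eq) (simp add: deg_add deg_single)
      with less have deg: "deg \<gamma> + 2 = d" by simp
      have "attains ?V z0 d (\<lambda>k. \<gamma> k + single i 2 k)"
      proof (rule attains_sphere[OF _ deg])
        show "h_sphere x = 0" if "x \<in> ?V z" for z x
          using that by (auto simp: V_complex_def split: prod.splits)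
        show "attains ?V z0 d (\<lambda>k. \<gamma> k + single j 2 k)" if "j \<noteq> i" for j
        proof (rule less.hyps)
          show "deg (\<lambda>k. \<gamma> k + single j 2 k) = d"
            using deg by (simp add: deg_add deg_single)
        qed (use that True in \<open>auto simp: \<gamma>_def single_def\<close>)
      qed
      with eq show ?thesis by simp
    next
      case False
      \<comment> \<open>Here \<beta>_i \<le> m + 1, so the other exponents sum to at least (n - 1)m
        + 1. The summand 2 in \<open>d\<close> makes this exceed (n - 1)m, and a second exponent
        reaches \<open>m\<close>.\<close>
      have "deg \<beta> = \<beta> i + (\<Sum>j\<in>UNIV - {i}. \<beta> j)"
        unfolding deg_def by (rule sum.remove) auto
      moreover have "CARD('n) * ?m = (CARD('n) - 1) * ?m + ?m"
        by (metis Suc_diff_1 add.commute mult_Suc zero_less_card_finite)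
      ultimately have "(\<Sum>j\<in>UNIV - {i}. \<beta> j) > (CARD('n) - 1) * ?m"
        using False less.prems d by linarith
      moreover have "(CARD('n) - 1) * (?m - 1) \<le> (CARD('n) - 1) * ?m" by simp
      ultimately have "(\<Sum>j\<in>UNIV - {i}. \<beta> j) > (CARD('n) - 1) * (?m - 1)" by linarith
      then have "(\<Sum>j\<in>UNIV - {i}. \<beta> j) > card (UNIV - {i}) * (?m - 1)"
        by (simp add: card_Diff_singleton)
      then obtain j where "j \<noteq> i" "?m \<le> \<beta> j"
        using exists_large_entry[of "UNIV - {i}" ?m \<beta>] by auto
      with less.prems show ?thesis by (intro two[of \<beta> i j]) auto
    qed
  qed
  have "CARD('n) * (?m - 1) \<le> CARD('n) * ?m" by simp
  then have "(\<Sum>i\<in>UNIV. \<beta> i) > CARD('n) * (?m - 1)"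
    using \<beta> d unfolding deg_def by linarith
  then obtain i where "?m \<le> \<beta> i"
    using exists_large_entry[of UNIV ?m \<beta>] by auto
  with \<beta> show ?thesis by (rule one)
qed

section \<open>Zariski density and the conclusion\<close>

text \<open>On the line through \<open>a\<close> and \<open>b\<close> both functions become nonzero
  univariate polynomials. Together they have finitely many roots, and the line has infinitely many
  points.\<close>

lemma real_polynomial_functions_common_nonzero:
  fixes p q :: "'a::euclidean_space \<Rightarrow> real"
  assumes p: "real_polynomial_function p" "p a \<noteq> 0" and q: "real_polynomial_function q" "q b \<noteq> 0"
  shows "\<exists>z. p z \<noteq> 0 \<and> q z \<noteq> 0"
proof -
  define line where "line t = a + t *\<^sub>R (b - a)" for t :: real
  have line: "polynomial_function line"
    unfolding line_def
    by (intro polynomial_function_add polynomial_function_const polynomial_function_bounded_linear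
        bounded_linear_scaleR_left)
  have roots: "finite {t. (f \<circ> line) t = 0}" if f: "real_polynomial_function f" "f (line s) \<noteq> 0" for f s
  proof -
    have "real_polynomial_function (f \<circ> line)"
      using line f(1) by (rule real_polynomial_function_compose)
    then obtain c n where c: "f \<circ> line = (\<lambda>t. \<Sum>i\<le>n. c i * t ^ i)"
      unfolding real_polynomial_function_iff_sum by auto
    then have "(\<Sum>i\<le>n. c i * s ^ i) \<noteq> 0" using f(2) by (metis comp_apply)
    then have "\<exists>i\<le>n. c i \<noteq> 0" by (metis (mono_tags, lifting) atMost_iff mult_zero_left sum.neutral)
    then show ?thesis unfolding c by (auto simp: polyfun_finite_roots)
  qed
  have "finite ({t. (p \<circ> line) t = 0} \<union> {t. (q \<circ> line) t = 0})"
    \<comment> \<open>The parameters 0 and 1 give the points \<open>a\<close> and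
      \<open>b\<close>.\<close>
    using roots[OF p(1), of 0] roots[OF q(1), of 1] p q by (simp add: line_def)
  then obtain t where "t \<notin> {t. (p \<circ> line) t = 0} \<union> {t. (q \<circ> line) t = 0}"
    using ex_new_if_finite infinite_UNIV_char_0 by blast
  then show ?thesis by auto
qed

text \<open>The nonvanishing set of \<open>p\<close> is open, and dense because a nonempty open set
  contains the nonvanishing set of some polynomial \<open>q\<close>, which meets that of
  \<open>p\<close>.\<close>

lemma holds_generically_if_nonzero:
  fixes p :: "'a::euclidean_space \<Rightarrow> real"
  assumes p: "real_polynomial_function p" "p a \<noteq> 0" and "\<And>z. p z \<noteq> 0 \<Longrightarrow> P z"
  shows "holds_generically P"
  unfolding holds_generically_def
proof (intro exI[of _ "{z. p z \<noteq> 0}"] conjI)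
  show "openin zariski_topology {z. p z \<noteq> 0}"
    unfolding openin_zariski_topology zariski_open_def using p
    by (intro exI[of _ "{p}"]) auto
  have "x \<in> zariski_topology closure_of {z. p z \<noteq> 0}" for x
    unfolding in_closure_of topspace_zariski_topology openin_zariski_topology
  proof (intro conjI UNIV_I allI impI, elim conjE)
    fix T assume "x \<in> T" "zariski_open T"
    then obtain S where S: "\<forall>q\<in>S. real_polynomial_function q" "- T = {x. \<forall>q\<in>S. q x = 0}"
      unfolding zariski_open_def by auto
    with \<open>x \<in> T\<close> obtain q where q: "q \<in> S" "q x \<noteq> 0" by blast
    with S(1) have "real_polynomial_function q" by blast
    from real_polynomial_functions_common_nonzero[OF p this q(2)]
    obtain z where "p z \<noteq> 0" "q z \<noteq> 0" by blast
    moreover from this S(2) q(1) have "z \<in> T" by blast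
    ultimately show "\<exists>y. y \<in> {z. p z \<noteq> 0} \<and> y \<in> T" by blast
  qed
  then show "zariski_topology closure_of {z. p z \<noteq> 0} = topspace zariski_topology"
    by (auto simp: topspace_zariski_topology)
qed (use assms in auto)

theorem proposition5p4:
  "holds_generically
     (\<lambda>(A :: ('m::{finite,linorder}, 'n::{finite,linorder}) tensor, B :: ('m, 'n) tensor).
        finite (V_complex A B) \<and> finite (V_real A B))"
proof -
  let ?V = "\<lambda>(A :: ('m, 'n) tensor, B :: ('m, 'n) tensor). V_complex A B"
  \<comment> \<open>An injection of the index type into the naturals supplies the distinct diagonal
    entries of the base point.\<close>
  obtain w :: "'n \<Rightarrow> nat" where "inj w"
    using finite_imp_inj_to_nat_seg[of "UNIV :: 'n set"] by auto
  then have w: "inj (real \<circ> w)" by (auto simp: inj_on_def)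
  obtain p a where "real_polynomial_function p" "p a \<noteq> 0" and p: "\<And>z. p z \<noteq> 0 \<Longrightarrow> finite (?V z)"
    using generically_finite_if_attains[of "CARD('n) * CARD('m) + 2" ?V, OF _ attains_all[OF w refl refl]]
    by auto
  then show ?thesis
    by (intro holds_generically_if_nonzero[of p a]) (auto simp: V_real_def split: prod.splits)
qed

end
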